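(* Let $X$ be a rank-one subshift, with cut sequence $(r_n)$ and spacer sequence $(s_{n,i})$, and suppose there is a positive integer $d$ such that for all sufficiently large $n$: $s_{n,r_n}=0$, $s_{n,i}\in\{0,d\}$ for all $0\le i<r_n$, and $s_{n,i}$ is not constant over $0\le i<r_n$. Let $p$ be its complexity function and $h_n$ the length of $B_n$. Then there exists a constant $C$ such that for all sufficiently large $n$ there exists $q_n\ge h_n$ with $$p(q_n)\ge 1.5q_n+\big(p(h_n)-h_n\big)-C.$$
   Context: A rank-one subshift with cut sequence $(r_n)_{n\ge1}$ (positive integers) and spacer sequence $(s_{n,i})_{n\ge1,\,0\le i\le r_n}$ (nonnegative integers) is defined by $B_1=0$, $B_{n+1}=B_n1^{s_{n,0}}B_n1^{s_{n,1}}\cdots B_n1^{s_{n,r_n}}$; it is the set of $x\in\{0,1\}^{\mathbb Z}$ all of whose finite subwords are subwords of some $B_n$. The complexity $p(q)$ is the number of distinct words of length $q$ occurring in elements of the subshift. *)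

theory Defs
  imports Complex_Main "HOL-Library.Sublist"
begin

text \<open>Blocks B_n of a rank-one subshift, for n \<ge> 1 (index 0 is unused and set to [0]).
  B_1 = 0, B_{n+1} = B_n 1^{s n 0} B_n 1^{s n 1} ... B_n 1^{s n (r n)}.\<close>
fun rk1_block :: "(nat \<Rightarrow> nat) \<Rightarrow> (nat \<Rightarrow> nat \<Rightarrow> nat) \<Rightarrow> nat \<Rightarrow> nat list" where
  "rk1_block r s 0 = [0]"
| "rk1_block r s (Suc 0) = [0]"
| "rk1_block r s (Suc (Suc n)) =
     concat (map (\<lambda>i. rk1_block r s (Suc n) @ replicate (s (Suc n) i) 1) [0..<r (Suc n) + 1])"

definition seq_word :: "(int \<Rightarrow> nat) \<Rightarrow> int \<Rightarrow> nat \<Rightarrow> nat list" where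
  "seq_word x i q = map (\<lambda>k. x (i + int k)) [0..<q]"

definition rk1_subshift :: "(nat \<Rightarrow> nat) \<Rightarrow> (nat \<Rightarrow> nat \<Rightarrow> nat) \<Rightarrow> (int \<Rightarrow> nat) set" where
  "rk1_subshift r s = {x. (\<forall>i. x i \<in> {0,1}) \<and>
      (\<forall>i q. \<exists>n\<ge>1. sublist (seq_word x i q) (rk1_block r s n))}"

definition rk1_complexity :: "(nat \<Rightarrow> nat) \<Rightarrow> (nat \<Rightarrow> nat \<Rightarrow> nat) \<Rightarrow> nat \<Rightarrow> nat" where
  "rk1_complexity r s q = card {w. \<exists>x\<in>rk1_subshift r s. \<exists>i. w = seq_word x i q}"

end

(*
  For n large write B_n = A 1^e with A beginning and ending in 0; the exponent e does not depend on
  n, and every spacer between consecutive copies of A is e or e + d.  The increment p(q+1) - p(q)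
  is at least the number of right special words of length q, and the suffixes of the blocks B_m
  provide one right special word of each length.  So it suffices to exhibit, up to a bounded error,
  q/2 further right special words with lengths in [h_n, q).

  Let U be the word over the two spacers that spells B_{n+2} in terms of B_n, let z be its last
  letter and y the other one.  Both U z U and U y U occur.  If a stretch of period k ends at some
  letter, its suffix shortened by k is followed by both letters, and this yields the extra words:
  - if yy occurs, take the right special word y;
  - otherwise U begins with z^a' y and ends with y z^a.  If a < a', take z^(a+a'); if a > a', read
    the subshift backwards, which does not change p;
  - if a = a', then z^(a+1) occurs in U, so U leaves the period z^a y at both ends.  If this happens
    through a shorter run z^b, take y z^a y z^b.  Otherwise U begins with (z^a y)^I z^(a+1) and ends
    with z^(a+1) (y z^a)^J, where J <= I after reversal if necessary, and the suffixes of z^(2a)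
    together with those of z^a (y z^a)^(I+J) are enough.
*)
theory Submission
  imports Defs
begin

section \<open>Right special words over two spacers\<close>

text \<open>\<open>True\<close> encodes the spacer \<open>e + d\<close>, \<open>False\<close> the
  spacer \<open>e\<close>. With \<open>h\<close> the length of \<open>A 1^e\<close>, this is the
  length of the word spelled by \<open>u\<close>, without a closing \<open>A\<close>.\<close>

definition weight :: "nat \<Rightarrow> nat \<Rightarrow> bool list \<Rightarrow> nat" where
  "weight h d u = sum_list (map (\<lambda>x. h + (if x then d else 0)) u)"

lemma weight_simps [simp]:
  "weight h d [] = 0"
  "weight h d (x # u) = h + (if x then d else 0) + weight h d u"
  "weight h d (u @ v) = weight h d u + weight h d v"
  by (simp_all add: weight_def)

lemma weight_replicate [simp]: "weight h d (replicate n x) = n * weight h d [x]"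
  by (induction n) auto

lemma weight_power [simp]: "weight h d (concat (replicate n u)) = n * weight h d u"
  by (induction n) auto

text \<open>Both one-letter extensions may be found in different words \<open>U t U\<close>.\<close>

definition special_between :: "bool list \<Rightarrow> bool list \<Rightarrow> bool" where
  "special_between U v \<longleftrightarrow> (\<forall>x. \<exists>t. sublist (v @ [x]) (U @ [t] @ U))"

text \<open>The spelling of \<open>v\<close> has length \<open>weight v + h\<close>. Up to a constant, \<open>weight v - weight w\<close> of
  its suffixes are not suffixes of the spelling of \<open>U\<close>, and the inequality says that this is at
  least half of the length. In \<open>two_families\<close>, the word \<open>c\<close> separates the suffixes of
  \<open>v1\<close> from those of \<open>v2\<close>.\<close>

definition one_family :: "nat \<Rightarrow> nat \<Rightarrow> bool list \<Rightarrow> bool" where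
  "one_family h d U \<longleftrightarrow> (\<exists>v w x. special_between U v \<and> suffix ((\<not> x) # w) v \<and> suffix (x # w) U
      \<and> 2 * weight h d w + h \<le> weight h d v)"

definition two_families :: "nat \<Rightarrow> nat \<Rightarrow> bool list \<Rightarrow> bool" where
  "two_families h d U \<longleftrightarrow> (\<exists>v1 w1 x1 v2 w2 x2 c x.
      special_between U v1 \<and> suffix ((\<not> x1) # w1) v1 \<and> suffix (x1 # w1) U
      \<and> special_between U v2 \<and> suffix ((\<not> x2) # w2) v2 \<and> suffix (x2 # w2) U
      \<and> suffix (x # c) v1 \<and> suffix ((\<not> x) # c) v2
      \<and> weight h d c \<le> weight h d w1 \<and> weight h d c \<le> weight h d w2
      \<and> weight h d v1 \<le> weight h d v2
      \<and> 2 * weight h d w1 + 2 * weight h d w2 + h \<le> 2 * weight h d v1 + weight h d v2)"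

section \<open>Families of special words from the shape of the two ends\<close>

lemma special_betweenI:
  assumes "sublist (v @ [z]) (U @ [t] @ U)" "sublist (v @ [\<not> z]) (U @ [t'] @ U)"
  shows "special_between U v"
  unfolding special_between_def
proof
  fix x show "\<exists>t. sublist (v @ [x]) (U @ [t] @ U)"
    using assms by (cases "x = z") auto
qed

lemma weight_letter_ge: "h \<le> weight h d [z]"
  by simp

text \<open>Since \<open>U\<close> ends in \<open>z\<close>, its last \<open>\<not> z\<close> is
  followed by \<open>z\<close>; the square supplies the other extension of
  \<open>[\<not> z]\<close>. This word differs from \<open>U\<close> in the last letter already, so
  \<open>w\<close> is empty.\<close>

lemma one_family_square:
  assumes "suffix [z] U" "(\<not> z) \<in> set U" "sublist [\<not> z, \<not> z] (U @ [t] @ U)"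
  shows "one_family h d U"
proof -
  obtain U1 U2 where U: "U = U1 @ (\<not> z) # U2" "(\<not> z) \<notin> set U2"
    using split_list_last[OF assms(2)] by blast
  have "U2 \<noteq> []" using U(1) assms(1) by (auto simp: suffix_def)
  then obtain y U3 where "U2 = y # U3" by (cases U2) auto
  with U have "U = U1 @ [\<not> z, z] @ U3" by auto
  hence "U @ [z] @ U = U1 @ [\<not> z, z] @ (U3 @ z # U)" by simp
  hence "sublist [\<not> z, z] (U @ [z] @ U)" unfolding sublist_def by blast
  hence "special_between U [\<not> z]" using assms(3) by (intro special_betweenI) auto
  thus ?thesis unfolding one_family_def using assms(1)
    by (intro exI[of _ "[\<not> z]"] exI[of _ "[]"] exI[of _ z]) auto
qed

text \<open>In \<open>U z U\<close> the two end runs and the letter between them merge into one run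
  of length a + 1 + a'. Its first a + a' letters are followed by \<open>z\<close>, its last a + a'
  letters by \<open>\<not> z\<close>.\<close>

lemma one_family_run:
  assumes "U = U1 @ (\<not> z) # replicate a z" "U = replicate a' z @ (\<not> z) # U2" "a < a'"
  shows "one_family h d U"
proof -
  let ?v = "replicate (a + a') z"
  have UU: "U @ [z] @ U = (U1 @ [\<not> z]) @ replicate (a + 1 + a') z @ (\<not> z) # U2"
    by (subst assms(1), subst assms(2)) (simp add: replicate_add replicate_append_same)
  have vz: "?v @ [z] = replicate (a + 1 + a') z"
    by (simp only: replicate_append_same replicate_Suc[symmetric]) simp
  have "U @ [z] @ U = (U1 @ [\<not> z]) @ (?v @ [z]) @ (\<not> z) # U2"
    unfolding UU vz ..
  moreover have "U @ [z] @ U = (U1 @ [\<not> z, z]) @ (?v @ [\<not> z]) @ U2"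
    unfolding UU by simp
  ultimately have "special_between U ?v"
    by (intro special_betweenI[of _ z _ z z]) (metis sublist_def)+
  moreover have "?v = replicate (a' - 1) z @ (\<not> \<not> z) # replicate a z"
    using assms(3) by (simp flip: replicate_Suc replicate_add)
  hence "suffix ((\<not> \<not> z) # replicate a z) ?v" unfolding suffix_def by blast
  moreover have "suffix ((\<not> z) # replicate a z) U" using assms(1) by (simp add: suffix_def)
  moreover have "2 * weight h d (replicate a z) + h \<le> weight h d ?v"
  proof -
    \<comment> \<open>As a < a', the word \<open>?v\<close> has at least 2a + 1 letters; the odd one
      pays for \<open>h\<close>.\<close>
    have "(2 * a + 1) * weight h d [z] \<le> (a + a') * weight h d [z]"
      using assms(3) by (intro mult_le_mono1) simp
    thus ?thesis using weight_letter_ge[of h d z]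
      unfolding weight_replicate by (simp add: algebra_simps del: weight_simps)
  qed
  ultimately show ?thesis unfolding one_family_def by blast
qed

lemma power_shift: "concat (replicate n (y # u)) @ [y] = y # concat (replicate n (u @ [y]))"
  by (induction n) auto

lemma power_Suc_right: "concat (replicate (Suc n) u) = concat (replicate n u) @ u"
  by (induction n) auto

lemma power_add: "concat (replicate (m + n) u) = concat (replicate m u) @ concat (replicate n u)"
  by (simp add: replicate_add)

text \<open>Write y for \<open>\<not> z\<close>. The seam of \<open>U y U\<close> lies in a stretch
  of period y z^a that breaks off with a run z^b that is too short. Hence y z^a y z^b is followed by
  \<open>z\<close> inside the stretch and by y at its end.\<close>

lemma one_family_short_run:
  assumes "U = U1 @ (\<not> z) # replicate a z"
    and "U = concat (replicate (Suc i) (replicate a z @ [\<not> z])) @ replicate b z @ (\<not> z) # U2"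
    and "b < a"
  shows "one_family h d U"
proof -
  let ?y = "\<not> z" let ?v = "?y # replicate a z @ ?y # replicate b z"
  let ?P = "replicate a z @ [?y]"
  have za: "replicate a z = replicate b z @ z # replicate (a - b - 1) z"
    using assms(3) by (simp flip: replicate_Suc replicate_add)
  \<comment> \<open>The second \<open>U\<close> begins with a run of length a > b, so after b
    letters of it another \<open>z\<close> follows.\<close>
  have m: "U @ [?y] @ U = U1 @ (?v @ [z]) @ (replicate (a - b - 1) z @ [?y] @
      concat (replicate i ?P) @ replicate b z @ ?y # U2)"
    by (subst assms(1), subst assms(2)) (simp add: za[symmetric], simp add: za)
  have "U @ [?y] @ U = (U1 @ ?y # replicate a z) @ (?y # concat (replicate (Suc i) ?P)) @ replicate b z @ ?y # U2"
    by (subst assms(1), subst assms(2)) simp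
  also have "?y # concat (replicate (Suc i) ?P) = (concat (replicate i (?y # replicate a z))) @ ?y # replicate a z @ [?y]"
    unfolding power_shift[symmetric]
    by (metis append_assoc append_Cons concat_append concat.simps append_Nil2 replicate_append_same
        replicate_Suc)
  finally have "U @ [?y] @ U = (U1 @ ?y # replicate a z @ concat (replicate i (?y # replicate a z)))
      @ (?v @ [?y]) @ U2" by (simp only: append_assoc append_Cons append_Nil)
  with m have "special_between U ?v"
    by (intro special_betweenI[of _ z _ ?y ?y]) (metis sublist_def)+
  moreover have "suffix ((\<not> z) # replicate b z) ?v"
    by (metis append_Cons suffix_def)
  moreover have "suffix (z # replicate b z) U"
    unfolding assms(1) suffix_def
    using assms(3) 
    by (intro exI[of _ "U1 @ ?y # replicate (a - b - 1) z"])
      (simp flip: replicate_Suc replicate_add)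
  moreover have "2 * weight h d (replicate b z) + h \<le> weight h d ?v"
  proof -
    have "b * weight h d [z] \<le> a * weight h d [z]"
      using assms(3) by (intro mult_le_mono1) simp
    moreover have "weight h d ?v = (a + b) * weight h d [z] + 2 * weight h d [?y]"
      by (simp add: algebra_simps)
    ultimately show ?thesis using weight_letter_ge[of h d ?y]
      unfolding weight_replicate add_mult_distrib by linarith
  qed
  ultimately show ?thesis unfolding one_family_def by blast
qed

text \<open>Write y for \<open>\<not> z\<close>. \<open>U z U\<close> contains y z^(2a+1) y, and
  \<open>U y U\<close> contains z z^a (y z^a)^(I+J+1) z. Dropping one period from either periodic
  stretch leaves a word that is followed by both letters.\<close>

lemma two_families_long_runs:
  assumes "U = U1 @ replicate (Suc a) z @ concat (replicate J ((\<not> z) # replicate a z))"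
    and "U = concat (replicate I (replicate a z @ [\<not> z])) @ replicate (Suc a) z @ U2"
    and "a \<ge> 1" "1 \<le> J" "J \<le> I"
  shows "two_families h d U"
proof -
  define y where "y = (\<not> z)"
  define za where "za = replicate a z"
  define Q where "Q n = concat (replicate n (y # za))" for n
  have Suc_a: "replicate (Suc a) z = z # za" "replicate (Suc a) z = za @ [z]"
    by (simp_all add: za_def replicate_append_same)
  have Q_Suc: "Q (Suc n) = Q n @ y # za" "Q (Suc n) = y # za @ Q n" for n
    unfolding Q_def by (rule power_Suc_right) simp
  have Q_add: "Q (m + n) = Q m @ Q n" for m n
    unfolding Q_def by (rule power_add)
  have Q_shift: "y # concat (replicate n (za @ [y])) = Q n @ [y]" for n
    unfolding Q_def by (rule power_shift[symmetric])
  have U1: "U = U1 @ z # za @ Q J"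
    using assms(1) by (simp only: Suc_a(1) za_def[symmetric] y_def[symmetric] Q_def append_Cons append_Nil)
  \<comment> \<open>The separating letter in front rotates (z^a y)^I into (y z^a)^I y, the form in
    which \<open>U\<close> ends.\<close>
  have U2: "[y] @ U = Q I @ y # za @ z # U2"
  proof -
    have "U = concat (replicate I (za @ [y])) @ za @ z # U2"
      using assms(2) by (simp only: Suc_a(2) za_def[symmetric] y_def[symmetric] append_assoc append_Cons append_Nil)
    hence "[y] @ U = (y # concat (replicate I (za @ [y]))) @ za @ z # U2" by simp
    thus ?thesis unfolding Q_shift by simp
  qed
  \<comment> \<open>Compared from the right, \<open>v1\<close> leaves \<open>U\<close> after z^a,
    \<open>v2\<close> leaves \<open>U\<close> after z^a (y z^a)^J, and the two leave each other
    after z^a. This gives \<open>w1\<close>, \<open>w2\<close> and \<open>c\<close>.\<close>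
  define v1 where "v1 = za @ za"
  define v2 where "v2 = za @ Q (I + J)"
  obtain J' where J': "J = Suc J'" using assms(4) by (cases J) auto
  obtain I' where I': "I = Suc I'" using assms(4,5) by (cases I) auto
  have endU: "U = (U1 @ z # za @ Q J') @ y # za"
    unfolding U1 J' Q_Suc(1) by simp
  have begU: "\<exists>U3. U = za @ y # U3"
  proof -
    have "[y] @ U = [y] @ za @ (Q I' @ y # za @ z # U2)"
      unfolding U2 I' Q_Suc(2) by simp
    hence "U = za @ (Q I' @ y # za @ z # U2)" by simp
    thus ?thesis by (cases I') (auto simp: Q_Suc(2) Q_def)
  qed
  then obtain U3 where U3: "U = za @ y # U3" by blast
  have zc: "za @ z # w = z # za @ w" for w
    unfolding za_def by (simp add: replicate_app_Cons_same)
  have "U @ [z] @ U = ((U1 @ z # za @ Q J') @ y # za) @ [z] @ (za @ y # U3)"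
    using endU U3 by simp
  also have "\<dots> = (U1 @ z # za @ Q J' @ [y]) @ (v1 @ [z]) @ (y # U3)"
    by (simp add: v1_def zc)
  finally have m1: "sublist (v1 @ [z]) (U @ [z] @ U)" unfolding sublist_def by blast
  have "U @ [z] @ U = ((U1 @ z # za @ Q J') @ y # za) @ [z] @ (za @ y # U3)"
    using endU U3 by simp
  also have "\<dots> = (U1 @ z # za @ Q J' @ [y, z]) @ (v1 @ [y]) @ U3"
    by (simp add: v1_def zc)
  finally have m2: "sublist (v1 @ [y]) (U @ [z] @ U)" unfolding sublist_def by blast
  from m1 m2 have s1: "special_between U v1"
    unfolding y_def by (rule special_betweenI)
  have "U @ [y] @ U = (U1 @ z # za @ Q J) @ (Q I @ y # za @ z # U2)"
    using U1 U2 by simp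
  also have "\<dots> = U1 @ z # za @ Q (I + J) @ y # za @ z # U2"
    by (simp only: add.commute[of I J] Q_add append_assoc append_Cons)
  finally have UU: "U @ [y] @ U = U1 @ z # za @ Q (I + J) @ y # za @ z # U2" .
  also have "\<dots> = (U1 @ [z]) @ (v2 @ [y]) @ za @ z # U2"
    by (simp add: v2_def)
  finally have m3: "sublist (v2 @ [y]) (U @ [y] @ U)" unfolding sublist_def by blast
  note UU
  also have "U1 @ z # za @ Q (I + J) @ y # za @ z # U2 = U1 @ z # za @ Q (Suc (I + J)) @ z # U2"
    by (simp add: Q_Suc(1))
  also have "\<dots> = (U1 @ z # za @ [y]) @ (v2 @ [z]) @ U2"
    by (simp add: Q_Suc(2) v2_def)
  finally have m4: "sublist (v2 @ [z]) (U @ [y] @ U)" unfolding sublist_def by blast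
  from m4 m3 have s2: "special_between U v2"
    unfolding y_def by (rule special_betweenI)
  have "v2 = (za @ Q I') @ y # za @ Q J"
    by (simp add: v2_def I' Q_add Q_Suc(1) del: add_Suc)
  hence t2: "suffix ((\<not> z) # za @ Q J) v2" unfolding suffix_def y_def by blast
  have "v2 = (za @ Q (I + J')) @ y # za"
    by (simp add: v2_def J' Q_Suc(1))
  hence t2': "suffix ((\<not> z) # za) v2" unfolding suffix_def y_def by blast
  have "za = replicate (a - 1) z @ [z]"
    unfolding za_def using assms(3) by (simp add: replicate_append_same flip: replicate_Suc)
  hence "v1 = replicate (a - 1) z @ z # za" unfolding v1_def by (metis append.assoc append_Cons append_Nil)
  hence t1: "suffix (z # za) v1" unfolding suffix_def by blast
  have t1': "suffix ((\<not> z) # za) U" using endU unfolding suffix_def y_def by blast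
  have sufU: "suffix (z # za @ Q J) U" using U1 unfolding suffix_def by blast
  define Z Y where "Z = weight h d [z]" and "Y = weight h d [y]"
  have wza: "weight h d za = a * Z" by (simp only: za_def weight_replicate Z_def)
  define W where "W = Y + a * Z"
  have "weight h d (y # za) = W" using wza by (simp add: W_def Y_def)
  hence wQ: "weight h d (Q n) = n * W" for n by (simp only: Q_def weight_power)
  have w: "weight h d v1 = a * Z + a * Z" "weight h d za = a * Z"
     "weight h d (za @ Q J) = a * Z + J * W" "weight h d v2 = a * Z + (I * W + J * W)"
    by (simp_all only: v1_def v2_def weight_simps wza wQ add_mult_distrib)
  have "1 * Z \<le> a * Z" using assms(3) by (intro mult_le_mono1)
  hence hZ: "h \<le> a * Z" using weight_letter_ge[of h d z] unfolding Z_def by linarith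
  have le: "J * W \<le> I * W" using assms(5) by (intro mult_le_mono1)
  have "1 * W \<le> J * W" using assms(4) by (intro mult_le_mono1)
  moreover have "a * Z \<le> 1 * W" unfolding W_def by simp
  ultimately have aJ: "a * Z \<le> J * W" by (rule order.trans[rotated])
  \<comment> \<open>Here p is the weight of z^a, q = J * W and r = I * W, so q \<le> r is where
    \<open>J \<le> I\<close> enters.\<close>
  have arith: "2 * p + 2 * (p + q) + h \<le> 2 * (p + p) + (p + (r + q))" if "q \<le> r" "h \<le> p" for p q r
    using that by presburger
  have "weight h d za \<le> weight h d (za @ Q J)" "weight h d v1 \<le> weight h d v2"
    "2 * weight h d za + 2 * weight h d (za @ Q J) + h \<le> 2 * weight h d v1 + weight h d v2"
    unfolding w using arith[OF le hZ] aJ trans_le_add2[OF aJ, of "I * W"] by simp_all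
  with s1 s2 t1 t1' t2 t2' sufU show ?thesis unfolding two_families_def
    by - (rule exI[of _ v1], rule exI[of _ za], rule exI[of _ "\<not> z"], rule exI[of _ v2],
      rule exI[of _ "za @ Q J"], rule exI[of _ z], rule exI[of _ za], rule exI[of _ z], simp)
qed

section \<open>Runs in a two-letter word and the case distinction\<close>

lemma sublist_avoiding:
  assumes "sublist xs (ys @ y # zs)" "y \<notin> set xs"
  shows "sublist xs ys \<or> sublist xs zs"
proof -
  obtain ps ss where "ys @ y # zs = ps @ xs @ ss" using assms(1) by (auto simp: sublist_def)
  then consider us where "ys = ps @ us" "us @ y # zs = xs @ ss"
    | us where "ps = ys @ us" "y # zs = us @ xs @ ss"
    by (auto simp: append_eq_append_conv2)
  thus ?thesis
  proof cases
    case 1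
    from 1(2) consider vs where "us = xs @ vs" | vs where "xs = us @ vs" "y # zs = vs @ ss"
      by (auto simp: append_eq_append_conv2)
    thus ?thesis
    proof cases
      case 1
      hence "ys = ps @ xs @ vs" using \<open>ys = ps @ us\<close> by simp
      thus ?thesis unfolding sublist_def by blast
    next
      case 2
      hence "vs = []" using assms(2) by (cases vs) auto
      hence "ys = ps @ xs @ []" using 2 \<open>ys = ps @ us\<close> by simp
      thus ?thesis unfolding sublist_def by blast
    qed
  next
    case 2
    thus ?thesis using assms(2) by (cases us; cases xs) (auto simp: sublist_def)
  qed
qed

lemma const_run:
  assumes "(\<not> z) \<notin> set u"
  shows "u = replicate (length u) z"
proof (rule replicate_eqI)
  fix x assume "x \<in> set u"
  with assms have "x \<noteq> (\<not> z)" by blast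
  thus "x = z" by blast
qed simp

lemma bool_run_split:
  obtains (const) "u = replicate (length u) z"
  | (run) b u' where "u = replicate b z @ (\<not> z) # u'"
proof (cases "(\<not> z) \<in> set u")
  case True
  then obtain u1 u2 where "u = u1 @ (\<not> z) # u2" "(\<not> z) \<notin> set u1"
    by (meson split_list_first)
  moreover have "u1 = replicate (length u1) z"
    using calculation(2) by (rule const_run)
  ultimately show ?thesis using run by metis
next
  case False
  thus ?thesis by (intro const const_run)
qed

text \<open>Strip copies of z^a followed by \<open>\<not> z\<close> from the front until a run of
  another length appears. One must appear: an initial run of exactly a letters cannot contain
  z^(a+1), which therefore lies in the shorter rest.\<close>

lemma power_run_split:
  assumes "sublist (replicate (Suc a) z) u"
  obtains (short) i b u' where "u = concat (replicate i (replicate a z @ [\<not> z])) @ replicate b z @ (\<not> z) # u'" "b < a"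
  | (long) i u' where "u = concat (replicate i (replicate a z @ [\<not> z])) @ replicate (Suc a) z @ u'"
proof -
  have "(\<exists>i b u'. u = concat (replicate i (replicate a z @ [\<not> z])) @ replicate b z @ (\<not> z) # u' \<and> b < a)
    \<or> (\<exists>i u'. u = concat (replicate i (replicate a z @ [\<not> z])) @ replicate (Suc a) z @ u')"
    using assms
  proof (induction "length u" arbitrary: u rule: less_induct)
    case less
    have long: ?case if "u = replicate (Suc a) z @ u'" for u'
      using that by (intro disjI2 exI[of _ 0]) auto
    show ?case
    proof (cases rule: bool_run_split[of u z])
      case const
      hence "length u \<ge> Suc a"
        using sublist_length_le[OF less.prems] by simp
      hence "u = replicate (Suc a) z @ replicate (length u - Suc a) z"
        unfolding replicate_add[symmetric] using const by (metis le_add_diff_inverse)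
      thus ?thesis by (rule long)
    next
      case (run b u')
      consider "b < a" | "b = a" | "b > a" by linarith
      thus ?thesis
      proof cases
        case 1 thus ?thesis using run by (intro disjI1 exI[of _ 0] exI[of _ b] exI[of _ u']) simp
      next
        case 3
        have "u = replicate (Suc a) z @ replicate (b - Suc a) z @ (\<not> z) # u'"
          using 3 run by (metis append.assoc less_iff_Suc_add add_diff_cancel_left' plus_nat.simps(2) add_Suc_right replicate_add)
        thus ?thesis by (rule long)
      next
        case 2
        have "\<not> sublist (replicate (Suc a) z) (replicate a z)"
          using sublist_length_le by fastforce
        hence "sublist (replicate (Suc a) z) u'"
          using sublist_avoiding[of "replicate (Suc a) z" "replicate b z" "\<not> z" u'] less.prems run 2 by auto
        hence "(\<exists>i b u''. u' = concat (replicate i (replicate a z @ [\<not> z])) @ replicate b z @ (\<not> z) # u'' \<and> b < a)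
          \<or> (\<exists>i u''. u' = concat (replicate i (replicate a z @ [\<not> z])) @ replicate (Suc a) z @ u'')"
          using less.hyps[of u'] run by simp
        thus ?thesis
        proof (elim disjE exE conjE)
          fix i c u'' assume "u' = concat (replicate i (replicate a z @ [\<not> z])) @ replicate c z @ (\<not> z) # u''" "c < a"
          thus ?thesis using run 2 by (intro disjI1 exI[of _ "Suc i"] exI[of _ c] exI[of _ u'']) simp
        next
          fix i u'' assume "u' = concat (replicate i (replicate a z @ [\<not> z])) @ replicate (Suc a) z @ u''"
          thus ?thesis using run 2 by (intro disjI2 exI[of _ "Suc i"] exI[of _ u'']) simp
        qed
      qed
    qed
  qed
  thus ?thesis using short long by blast
qed

lemma rev_power: "rev (concat (replicate n u)) = concat (replicate n (rev u))"
  by (simp add: rev_concat)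

text \<open>The cases compare the runs at the two ends of \<open>U\<close>; passing to
  \<open>rev U\<close> interchanges the ends. The copies of \<open>S @ [t] @ S\<close> in
  \<open>U\<close> guarantee a run longer than both end runs when these are equal.\<close>

lemma families_exist:
  assumes "prefix S U" "suffix S U" "\<And>t. sublist (S @ [t] @ S) U" "True \<in> set S" "False \<in> set S"
  shows "one_family h d U \<or> two_families h d U \<or> one_family h d (rev U) \<or> two_families h d (rev U)"
proof -
  define z where "z = last S"
  define y where "y = (\<not> z)"
  have yS: "y \<in> set S" using assms(4,5) by (cases y) auto
  then obtain S1 V where V: "S = S1 @ y # V" "y \<notin> set V" by (meson split_list_last)
  define a where "a = length V"
  have Vz: "V = replicate a z"
    unfolding a_def using V(2) by (intro const_run) (auto simp: y_def)
  obtain W S2 where W: "S = W @ y # S2" "y \<notin> set W" using yS by (meson split_list_first)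
  define a' where "a' = length W"
  have Wz: "W = replicate a' z"
    unfolding a'_def using W(2) by (intro const_run) (auto simp: y_def)
  have S: "S = S1 @ (\<not> z) # replicate a z" "S = replicate a' z @ (\<not> z) # S2"
    using V W Vz Wz by (auto simp: y_def)
  obtain U1 where U1: "U = U1 @ (\<not> z) # replicate a z"
    using assms(2) S(1) by (auto simp: suffix_def)
  obtain U2 where U2: "U = replicate a' z @ (\<not> z) # U2"
    using assms(1) S(2) by (auto simp: prefix_def)
  have rU1: "rev U = replicate a z @ (\<not> z) # rev U1" by (subst U1) simp
  have rU2: "rev U = rev U2 @ (\<not> z) # replicate a' z" by (subst U2) simp
  have a1: "a \<ge> 1" using V(1) Vz z_def y_def by (cases a) auto
  show ?thesis
  proof (cases "\<exists>t. sublist [\<not> z, \<not> z] (U @ [t] @ U)")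
    case True
    moreover have "suffix [z] U"
      unfolding U1 suffix_def using a1
      by (intro exI[of _ "U1 @ (\<not> z) # replicate (a - 1) z"]) (simp add: replicate_append_same flip: replicate_Suc)
    ultimately show ?thesis using one_family_square[of z U] U1 by fastforce
  next
    case False
    have a'1: "a' \<ge> 1"
    proof (rule ccontr)
      assume "\<not> a' \<ge> 1"
      hence "U @ [\<not> z] @ U = U @ [\<not> z, \<not> z] @ U2" by (subst (2) U2) simp
      thus False using False unfolding sublist_def by blast
    qed
    consider "a < a'" | "a' < a" | "a = a'" by linarith
    thus ?thesis
    proof cases
      case 1 thus ?thesis using one_family_run[OF U1 U2] by blast
    next
      case 2 thus ?thesis using one_family_run[OF rU2 rU1] by blast
    next
      case 3
      \<comment> \<open>The last run of one \<open>S\<close>, the letter \<open>z\<close> and the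
        first run of the next \<open>S\<close> merge.\<close>
      have "S @ [z] @ S = (S1 @ [\<not> z]) @ replicate (Suc a) z @ (replicate a' z @ (\<not> z) # S2)"
        by (subst S(1), subst S(2)) (simp flip: replicate_append_same)
      hence "sublist (replicate (Suc a) z) (S @ [z] @ S)" unfolding sublist_def by blast
      hence sub: "sublist (replicate (Suc a) z) U" using assms(3) sublist_order.order_trans by blast
      have nsub: "\<not> sublist (replicate (Suc a) z) (replicate a z)"
        using sublist_length_le by fastforce
      \<comment> \<open>The long run lies beyond the initial z^a and its closing letter, so at least
        one full period precedes the break. The same holds at the other end, which makes both
        exponents positive.\<close>
      have sub2: "sublist (replicate (Suc a) z) U2"
        using sublist_avoiding[of "replicate (Suc a) z" "replicate a' z" "\<not> z" U2] nsub 3 U2 sub by auto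
      have "sublist (replicate (Suc a) z) (rev U)" using sub
        by (metis rev_replicate sublist_rev)
      hence sub1: "sublist (replicate (Suc a) z) (rev U1)"
        using sublist_avoiding[of "replicate (Suc a) z" "replicate a z" "\<not> z" "rev U1"] nsub rU1 by auto
      from sub2 show ?thesis
      proof (cases rule: power_run_split)
        case (short i b u')
        thus ?thesis using one_family_short_run[OF U1, of i b u' h d] U2 3 by simp
      next
        case L: (long i u')
        have UL: "U = concat (replicate (Suc i) (replicate a z @ [\<not> z])) @ replicate (Suc a) z @ u'"
          using L U2 3 by simp
        from sub1 show ?thesis
        proof (cases rule: power_run_split)
          case (short j b u'')
          have "one_family h d (rev U)"
            by (rule one_family_short_run[of _ "rev U2" z a j b u'']) (use rU1 rU2 3 short in simp_all)
          thus ?thesis by simp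
        next
          case R: (long j u'')
          have rUR: "rev U = concat (replicate (Suc j) (replicate a z @ [\<not> z])) @ replicate (Suc a) z @ u''"
            using R rU1 by simp
          have rev_a: "rev (replicate a z @ [\<not> z]) = (\<not> z) # replicate a z" by simp
          have UR: "U = rev u'' @ replicate (Suc a) z @ concat (replicate (Suc j) ((\<not> z) # replicate a z))"
            using arg_cong[OF rUR, of rev] unfolding rev_append rev_power rev_a by (simp add: replicate_append_same)
          have rUL: "rev U = rev u' @ replicate (Suc a) z @ concat (replicate (Suc i) ((\<not> z) # replicate a z))"
            using arg_cong[OF UL, of rev] unfolding rev_append rev_power rev_a by (simp add: replicate_append_same)
          show ?thesis
          \<comment> \<open>Reversal exchanges the exponents, so the smaller one can be put at the
            right end.\<close>
          proof (cases "j \<le> i")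
            case True
            thus ?thesis using two_families_long_runs[OF UR UL a1] by simp
          next
            case False
            thus ?thesis using two_families_long_runs[OF rUL rUR a1] by simp
          qed
        qed
      qed
    qed
  qed
qed

section \<open>Complexity of a language spelled by two return words\<close>

text \<open>The language is abstract so that the counting applies both to the words of the subshift
  and to their reversals.\<close>

locale binary_language =
  fixes L :: "nat list set"
  assumes factor: "w \<in> L \<Longrightarrow> sublist u w \<Longrightarrow> u \<in> L"
    and binary: "w \<in> L \<Longrightarrow> set w \<subseteq> {0, 1}"
    and extend: "w \<in> L \<Longrightarrow> \<exists>a. w @ [a] \<in> L"
begin

definition complexity :: "nat \<Rightarrow> nat" where
  "complexity q = card {w \<in> L. length w = q}"

definition special :: "nat list \<Rightarrow> bool" where
  "special w \<longleftrightarrow> w @ [0] \<in> L \<and> w @ [1] \<in> L"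

lemma finite_length [simp]: "finite {w \<in> L. length w = q}"
proof (rule finite_subset)
  show "{w \<in> L. length w = q} \<subseteq> {w. set w \<subseteq> {0, 1} \<and> length w = q}" using binary by blast
  show "finite {w. set w \<subseteq> {0::nat, 1} \<and> length w = q}" by (rule finite_lists_length_eq) simp
qed

lemma special_in: "special w \<Longrightarrow> w \<in> L"
  unfolding special_def by (rule factor[of "w @ [0]"]) simp_all

lemma special_suffix:
  assumes "special w" "suffix u w"
  shows "special u"
proof -
  obtain k where k: "w = k @ u" using assms(2) unfolding suffix_def by blast
  have "sublist (u @ [x]) (w @ [x])" for x
    unfolding k by simp
  with assms(1) show ?thesis unfolding special_def by (meson factor)
qed

lemma finite_special [simp]: "finite {w. special w \<and> length w = q}"
  by (rule finite_subset[OF _ finite_length[of q]]) (auto dest: special_in)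

text \<open>Each word has an extension \<open>f w\<close>, and a right special word has a second
  one. As \<open>f\<close> prefers the letter 0, the extensions of special words by 1 are never
  values of \<open>f\<close>.\<close>

lemma complexity_Suc: "complexity q + card {w. special w \<and> length w = q} \<le> complexity (Suc q)"
proof -
  define f where "f w = (if w @ [0] \<in> L then w @ [0::nat] else w @ [1])" for w
  let ?A = "{w \<in> L. length w = q}" and ?R = "{w. special w \<and> length w = q}"
  let ?g = "\<lambda>w. w @ [1::nat]"
  have f: "f w \<in> L" if "w \<in> L" for w
  proof -
    obtain a where a: "w @ [a] \<in> L" using extend[OF \<open>w \<in> L\<close>] ..
    hence "a \<in> {0, 1}" using binary[OF a] by simp
    thus ?thesis using a unfolding f_def by auto
  qed
  have "inj_on f ?A" by (rule inj_on_inverseI[of _ butlast]) (simp add: f_def)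
  moreover have "inj_on ?g ?R" by (rule inj_onI) simp
  moreover have "f u \<noteq> ?g w" if "special w" for u w
    using that by (cases "u = w") (simp_all add: f_def special_def)
  hence "f ` ?A \<inter> ?g ` ?R = {}" by blast
  ultimately have "card (f ` ?A \<union> ?g ` ?R) = complexity q + card ?R"
    unfolding complexity_def by (subst card_Un_disjoint) (simp_all only: card_image finite_imageI finite_length finite_special)
  moreover have "f ` ?A \<union> ?g ` ?R \<subseteq> {w \<in> L. length w = Suc q}"
  proof (intro Un_least image_subsetI CollectI conjI)
    show "f w \<in> L" if "w \<in> ?A" for w using f that by blast
    show "?g w \<in> L" if "w \<in> ?R" for w using that by (simp add: special_def)
  qed (simp_all add: f_def)
  hence "card (f ` ?A \<union> ?g ` ?R) \<le> complexity (Suc q)"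
    unfolding complexity_def by (intro card_mono finite_length)
  ultimately show ?thesis by simp
qed

text \<open>Sums the increments over the lengths from \<open>h\<close> to q - 1, with
  \<open>E\<close> sorted by length.\<close>

lemma complexity_special:
  assumes "h \<le> q" "\<And>w. w \<in> E \<Longrightarrow> special w \<and> h \<le> length w \<and> length w < q"
  shows "complexity h + card E \<le> complexity q"
proof -
  let ?R = "\<lambda>l. {w. special w \<and> length w = l}"
  have "complexity h + (\<Sum>l = h..<q. card (?R l)) \<le> complexity q"
    using assms(1)
  proof (induction q rule: dec_induct)
    case (step n) thus ?case using complexity_Suc[of n] by simp
  qed simp
  moreover have "card E \<le> (\<Sum>l = h..<q. card (?R l))"
  proof -
    have "E \<subseteq> (\<Union>l\<in>{h..<q}. ?R l)" using assms(2) by auto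
    hence "card E \<le> card (\<Union>l\<in>{h..<q}. ?R l)" by (intro card_mono) auto
    also have "\<dots> \<le> (\<Sum>l = h..<q. card (?R l))" by (intro card_UN_le) simp
    finally show ?thesis .
  qed
  ultimately show ?thesis by linarith
qed

end

section \<open>Suffixes of spelled words\<close>

definition lastn :: "nat \<Rightarrow> 'a list \<Rightarrow> 'a list" where
  "lastn l w = drop (length w - l) w"

lemma suffix_lastn: "suffix (lastn l w) w"
  by (simp add: lastn_def suffix_drop)

lemma length_lastn [simp]: "l \<le> length w \<Longrightarrow> length (lastn l w) = l"
  by (simp add: lastn_def)

lemma lastn_append:
  assumes "length v \<le> l" "suffix v w"
  shows "suffix v (lastn l w)"
proof -
  obtain k where "w = k @ v" using assms(2) unfolding suffix_def by blast
  hence "lastn l w = drop (length k + length v - l) k @ v" using assms(1) by (simp add: lastn_def)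
  thus ?thesis unfolding suffix_def by blast
qed

text \<open>Distinct lengths give distinct suffixes. The bound keeps every \<open>l\<close> at most
  \<open>length w\<close>, beyond which \<open>lastn l w\<close> would stay
  \<open>w\<close>.\<close>

lemma card_lastn: "b \<le> Suc (length w) \<Longrightarrow> card ((\<lambda>l. lastn l w) ` {a..<b}) = b - a"
proof -
  assume "b \<le> Suc (length w)"
  hence "inj_on (\<lambda>l. lastn l w) {a..<b}"
    by (intro inj_on_inverseI[of _ length]) auto
  thus ?thesis by (simp add: card_image)
qed

definition spell :: "nat list \<Rightarrow> nat \<Rightarrow> nat \<Rightarrow> bool list \<Rightarrow> nat list" where
  "spell A e d u = concat (map (\<lambda>x. A @ replicate (e + (if x then d else 0)) 1) u)"

lemma spell_simps [simp]:
  "spell A e d [] = []"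
  "spell A e d (x # u) = A @ replicate (e + (if x then d else 0)) 1 @ spell A e d u"
  "spell A e d (u @ v) = spell A e d u @ spell A e d v"
  by (simp_all add: spell_def)

lemma length_spell [simp]: "length (spell A e d u) = weight (length A + e) d u"
  by (induction u) auto

text \<open>With the closing \<open>A\<close> every spacer stands between two copies of
  \<open>A\<close>, which makes the pattern symmetric.\<close>

lemma rev_spell: "rev (spell A e d u @ A) = spell (rev A) e d (rev u) @ rev A"
  by (induction u) simp_all

text \<open>Whatever follows \<open>u\<close> in \<open>v\<close>, the spelling goes on with
  \<open>A\<close>.\<close>

lemma sublist_spell: "sublist u v \<Longrightarrow> sublist (spell A e d u @ A) (spell A e d v @ A)"
proof -
  assume "sublist u v"
  then obtain p q where v: "v = p @ u @ q" by (auto simp: sublist_def)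
  have "\<exists>ss. spell A e d q @ A = A @ ss" by (cases q) auto
  then obtain ss where "spell A e d q @ A = A @ ss" ..
  hence "spell A e d v @ A = spell A e d p @ (spell A e d u @ A) @ ss" by (simp add: v)
  thus ?thesis unfolding sublist_def by blast
qed

text \<open>Reading backwards, the shorter spacer ends while the longer one continues.\<close>

lemma spell_marker:
  assumes "A \<noteq> []" "last A = 0" "d > 0"
  shows "suffix ((if x then 1 else 0) # replicate e 1 @ spell A e d c @ A @ replicate e 1)
    (spell A e d (x # c) @ A @ replicate e 1)"
proof (cases x)
  case True
  obtain d' where "d = Suc d'" using assms(3) by (cases d) auto
  hence "e + d = d' + Suc e" by simp
  hence "replicate (e + d) (1::nat) = replicate d' 1 @ 1 # replicate e 1"
    by (simp only: replicate_add replicate_Suc)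
  with True have "spell A e d (x # c) @ A @ replicate e 1 = (A @ replicate d' 1) @
     (if x then 1 else 0) # replicate e 1 @ spell A e d c @ A @ replicate e 1"
    by simp
  thus ?thesis unfolding suffix_def by blast
next
  case False
  have "A = butlast A @ [0]" using assms(1,2) append_butlast_last_id[of A] by simp
  then obtain A' where "A = A' @ [0]" ..
  with False have "spell A e d (x # c) @ A @ replicate e 1 = A' @
     (if x then 1 else 0) # replicate e 1 @ spell A e d c @ A @ replicate e 1"
    by simp
  thus ?thesis unfolding suffix_def by blast
qed

text \<open>Both words end in \<open>?T\<close>, preceded by 1 in one and by 0 in the other. A
  suffix of length \<open>l\<close> is longer than \<open>?T\<close> and shows this letter; if it
  equalled a suffix of the other word, that word would have both letters in one place.\<close>

lemma spell_suffixes_differ: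
  assumes A: "A \<noteq> []" "last A = 0" "d > 0"
    and "suffix (x # c) u" "suffix ((\<not> x) # c) u'"
    and "length A + e + e + weight (length A + e) d c < l"
  shows "lastn l (K @ spell A e d u @ A @ replicate e 1) \<noteq> lastn l' (K' @ spell A e d u' @ A @ replicate e 1)"
proof
  let ?T = "replicate e 1 @ spell A e d c @ A @ replicate e 1"
  have key: "suffix ((if x then 1 else 0) # ?T) (K @ spell A e d u @ A @ replicate e 1)"
    if suf: "suffix (x # c) u" for x u K
  proof -
    obtain u0 where "u = u0 @ x # c" using suf unfolding suffix_def by blast
    hence "K @ spell A e d u @ A @ replicate e 1
        = (K @ spell A e d u0) @ spell A e d (x # c) @ A @ replicate e 1" by simp
    thus ?thesis using spell_marker[OF A, of x e c] by (metis suffix_append)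
  qed
  have l: "length ?T < l" using assms(6) by simp
  assume eq: "lastn l (K @ spell A e d u @ A @ replicate e 1) = lastn l' (K' @ spell A e d u' @ A @ replicate e 1)"
    (is "?X = ?Y")
  have X: "suffix ((if x then 1 else 0) # ?T) ?X"
    by (rule lastn_append[OF _ key[OF assms(4)]]) (use l in simp)
  have "suffix ?Y (K' @ spell A e d u' @ A @ replicate e 1)" by (rule suffix_lastn)
  with X[unfolded eq] have "suffix ((if x then 1 else 0) # ?T) (K' @ spell A e d u' @ A @ replicate e 1)"
    by (rule suffix_order.order_trans)
  moreover have "suffix ((if \<not> x then 1 else 0) # ?T) (K' @ spell A e d u' @ A @ replicate e 1)"
    by (rule key[OF assms(5)])
  ultimately have "suffix ((if x then 1 else 0) # ?T) ((if \<not> x then 1 else 0) # ?T)"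
    by (rule suffix_length_suffix) simp
  then obtain zs where zs: "(if \<not> x then 1 else 0) # ?T = zs @ (if x then 1 else 0) # ?T"
    unfolding suffix_def by blast
  hence "zs = []" using arg_cong[OF zs, of length] by simp
  thus False using zs by (cases x) auto
qed

text \<open>\<open>U\<close> spells a block two levels up. \<open>twice\<close> provides the words
  in which special words are found, and \<open>stem\<close> provides right special words of
  unbounded length ending in the spelling of \<open>U\<close>, hence one of every length.\<close>

locale tower_language = binary_language +
  fixes A :: "nat list" and e d :: nat and U :: "bool list"
  assumes A: "A \<noteq> []" "hd A = 0" "last A = 0" and d: "d > 0"
    and twice: "spell A e d (U @ [t] @ U) @ A \<in> L"
    and stem: "\<exists>K. l \<le> length K \<and> special (K @ spell A e d U @ A @ replicate e 1)"
begin

abbreviation "h \<equiv> length A + e"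

text \<open>After the final \<open>A 1^e\<close> comes the 0 that begins the next \<open>A\<close>
  if the spacer is \<open>e\<close>, and a further 1 if it is \<open>e + d\<close>.\<close>

lemma special_spell:
  assumes "special_between U v"
  shows "special (spell A e d v @ A @ replicate e 1)"
proof -
  have ext: "spell A e d (v @ [x]) @ A \<in> L" for x
  proof -
    obtain t where "sublist (v @ [x]) (U @ [t] @ U)"
      using assms unfolding special_between_def by blast
    from factor[OF twice sublist_spell[OF this]] show ?thesis .
  qed
  obtain A' where A': "A = 0 # A'" using A by (cases A) auto
  have "spell A e d (v @ [False]) @ A = ((spell A e d v @ A @ replicate e 1) @ [0]) @ A'"
    by (simp add: A')
  moreover obtain d' where d': "d = Suc d'" using d by (cases d) auto
  have "spell A e d (v @ [True]) @ A = ((spell A e d v @ A @ replicate e 1) @ [1]) @ replicate d' 1 @ A"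
    by (simp add: d' replicate_add replicate_app_Cons_same)
  ultimately show ?thesis unfolding special_def
    using factor[OF ext[of True]] factor[OF ext[of False]] by simp
qed

text \<open>Two disjoint families of special words are counted: suffixes of the stem with lengths in
  [h, q), and suffixes of the spelling of \<open>v\<close> that are long enough to leave the
  stem.\<close>

lemma complexity_one_family:
  assumes "one_family h d U"
  shows "\<exists>q\<ge>h. 3 * q + 2 * complexity h \<le> 2 * complexity q + 2 * h + 4 * (e + 1)"
proof -
  from assms obtain v w x where v: "special_between U v" "suffix ((\<not> x) # w) v" "suffix (x # w) U"
    and wt: "2 * weight h d w + h \<le> weight h d v"
    unfolding one_family_def by blast
  define q where "q = weight h d v + h"
  obtain K where K: "q \<le> length K" "special (K @ spell A e d U @ A @ replicate e 1)"
    using stem by blast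
  let ?M = "K @ spell A e d U @ A @ replicate e 1" and ?V = "spell A e d v @ A @ replicate e 1"
  \<comment> \<open>Suffixes of this length reach beyond the letter in which \<open>v\<close> and
    \<open>U\<close> differ.\<close>
  define a where "a = weight h d w + h + e + 1"
  let ?E = "(\<lambda>l. lastn l ?M) ` {h..<q} \<union> (\<lambda>l. lastn l ?V) ` {a..<q}"
  have V: "length ?V = q" by (simp add: q_def)
  have "lastn l' ?M \<noteq> lastn l ?V" if "a \<le> l" for l l'
    using spell_suffixes_differ[OF A(1,3) d, of "\<not> x" w v U e l "[]" l' K] v that
    unfolding a_def by simp
  hence "(\<lambda>l. lastn l ?M) ` {h..<q} \<inter> (\<lambda>l. lastn l ?V) ` {a..<q} = {}" by auto
  hence "card ?E = (q - h) + (q - a)"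
    using K(1) V by (simp add: card_Un_disjoint card_lastn del: append_assoc)
  moreover have "complexity h + card ?E \<le> complexity q"
  proof (rule complexity_special)
    show "h \<le> q" by (simp add: q_def)
    fix w assume "w \<in> ?E"
    then consider l where "h \<le> l" "l < q" "w = lastn l ?M" | l where "a \<le> l" "l < q" "w = lastn l ?V"
      by auto
    thus "special w \<and> h \<le> length w \<and> length w < q"
    proof cases
      case 1 
      thus ?thesis using special_suffix[OF K(2) suffix_lastn] K(1) by simp
    next
      case 2
      moreover have "h \<le> a" by (simp add: a_def)
      ultimately show ?thesis using special_suffix[OF special_spell[OF v(1)] suffix_lastn] V by simp
    qed
  qed
  ultimately have "complexity h + ((q - h) + (q - a)) \<le> complexity q" by simp
  \<comment> \<open>The weight inequality amounts to 2a \<le> q + 2(e + 1).\<close>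
  thus ?thesis using wt by (intro exI[of _ q]) (auto simp: q_def a_def)
qed

text \<open>As with one family, but with three disjoint sets of suffixes. The suffixes of
  \<open>v1\<close> stop at length \<open>q1\<close>, those of \<open>v2\<close> and of the stem at
  \<open>q\<close>.\<close>

lemma complexity_two_families:
  assumes "two_families h d U"
  shows "\<exists>q\<ge>h. 3 * q + 2 * complexity h \<le> 2 * complexity q + 2 * h + 4 * (e + 1)"
proof -
  from assms obtain v1 w1 x1 v2 w2 x2 c x where
    v: "special_between U v1" "suffix ((\<not> x1) # w1) v1" "suffix (x1 # w1) U"
      "special_between U v2" "suffix ((\<not> x2) # w2) v2" "suffix (x2 # w2) U"
      "suffix (x # c) v1" "suffix ((\<not> x) # c) v2"
    and c: "weight h d c \<le> weight h d w1" "weight h d c \<le> weight h d w2"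
      "weight h d v1 \<le> weight h d v2"
    and wt: "2 * weight h d w1 + 2 * weight h d w2 + h \<le> 2 * weight h d v1 + weight h d v2"
    unfolding two_families_def by blast
  define q where "q = weight h d v2 + h"
  define q1 where "q1 = weight h d v1 + h"
  obtain K where K: "q \<le> length K" "special (K @ spell A e d U @ A @ replicate e 1)"
    using stem by blast
  let ?M = "K @ spell A e d U @ A @ replicate e 1"
  let ?V = "spell A e d v1 @ A @ replicate e 1" and ?W = "spell A e d v2 @ A @ replicate e 1"
  define a1 where "a1 = weight h d w1 + h + e + 1"
  define a2 where "a2 = weight h d w2 + h + e + 1"
  let ?EM = "(\<lambda>l. lastn l ?M) ` {h..<q}" and ?EV = "(\<lambda>l. lastn l ?V) ` {a1..<q1}"
    and ?EW = "(\<lambda>l. lastn l ?W) ` {a2..<q}"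
  have len: "length ?V = q1" "length ?W = q" "q1 \<le> q" using c(3) by (simp_all add: q_def q1_def)
  have "lastn l' ?M \<noteq> lastn l ?V" if "a1 \<le> l" for l l'
    using spell_suffixes_differ[OF A(1,3) d, of "\<not> x1" w1 v1 U e l "[]" l' K] v that
    unfolding a1_def by simp
  hence d1: "?EM \<inter> ?EV = {}" by auto
  have "lastn l' ?M \<noteq> lastn l ?W" if "a2 \<le> l" for l l'
    using spell_suffixes_differ[OF A(1,3) d, of "\<not> x2" w2 v2 U e l "[]" l' K] v that
    unfolding a2_def by simp
  hence "?EM \<inter> ?EW = {}" by auto
  \<comment> \<open>The weight of \<open>c\<close> is at most that of \<open>w1\<close>, so these
    suffixes show the letter before \<open>c\<close> as well.\<close>
  moreover have "lastn l ?V \<noteq> lastn l' ?W" if "a1 \<le> l" for l l'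
    using spell_suffixes_differ[OF A(1,3) d, of x c v1 v2 e l "[]" l' "[]"] v c that
    unfolding a1_def by simp
  hence "?EV \<inter> ?EW = {}" by auto
  ultimately have "(?EM \<union> ?EV) \<inter> ?EW = {}" by blast
  hence "card ((?EM \<union> ?EV) \<union> ?EW) = card (?EM \<union> ?EV) + card ?EW"
    by (intro card_Un_disjoint) auto
  also have "card (?EM \<union> ?EV) = card ?EM + card ?EV"
    using d1 by (intro card_Un_disjoint) auto
  also have "card ?EM = q - h" by (rule card_lastn) (use K(1) in simp)
  also have "card ?EV = q1 - a1" by (rule card_lastn) (use len in simp)
  also have "card ?EW = q - a2" by (rule card_lastn) (use len in simp)
  finally have "card ((?EM \<union> ?EV) \<union> ?EW) = (q - h) + (q1 - a1) + (q - a2)" .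
  moreover have "complexity h + card ((?EM \<union> ?EV) \<union> ?EW) \<le> complexity q"
  proof (rule complexity_special)
    show "h \<le> q" by (simp add: q_def)
    have ha: "h \<le> a1" "h \<le> a2" by (simp_all add: a1_def a2_def)
    fix w assume "w \<in> (?EM \<union> ?EV) \<union> ?EW"
    then consider l where "h \<le> l" "l < q" "w = lastn l ?M" | l where "a1 \<le> l" "l < q1" "w = lastn l ?V"
      | l where "a2 \<le> l" "l < q" "w = lastn l ?W"
      by auto
    thus "special w \<and> h \<le> length w \<and> length w < q"
    proof cases
      case 1 
      thus ?thesis using special_suffix[OF K(2) suffix_lastn] K(1) by simp
    next
      case 2
      thus ?thesis using special_suffix[OF special_spell[OF v(1)] suffix_lastn] len ha by simp
    next
      case 3
      thus ?thesis using special_suffix[OF special_spell[OF v(4)] suffix_lastn] len ha by simp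
    qed
  qed
  ultimately have "complexity h + ((q - h) + (q1 - a1) + (q - a2)) \<le> complexity q" by simp
  \<comment> \<open>The weight inequality amounts to 2 a1 + 2 a2 \<le> 2 q1 + q + 4(e + 1).\<close>
  thus ?thesis using wt by (intro exI[of _ q]) (auto simp: q_def q1_def a1_def a2_def)
qed

end

lemma sublist_spell_spacer:
  assumes "sublist u v"
  shows "sublist (spell A e d u @ A @ replicate e 1) (spell A e d v @ A @ replicate e 1)"
proof -
  obtain p q where v: "v = p @ u @ q" using assms by (auto simp: sublist_def)
  have "\<exists>ss. spell A e d q @ A @ replicate e 1 = A @ replicate e 1 @ ss"
    by (cases q) (auto simp: replicate_add)
  then obtain ss where "spell A e d q @ A @ replicate e 1 = A @ replicate e 1 @ ss" ..
  hence "spell A e d v @ A @ replicate e 1 = spell A e d p @ (spell A e d u @ A @ replicate e 1) @ ss"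
    by (simp add: v)
  thus ?thesis unfolding sublist_def by blast
qed

text \<open>The larger core begins and ends with \<open>A\<close>, so a spacer between two of its
  copies is also a spacer between two copies of \<open>A\<close>.\<close>

lemma spell_nested:
  "spell (spell A e d S @ A) e d T @ spell A e d S @ A
    = spell A e d (concat (map (\<lambda>t. S @ [t]) T) @ S) @ A"
  by (induction T) simp_all

lemma sublist_nested:
  assumes "t \<in> set T"
  shows "sublist (S @ [t] @ S) (concat (map (\<lambda>t. S @ [t]) T) @ S)"
proof -
  obtain p q where T: "T = p @ t # q" using assms by (meson split_list)
  have "\<exists>ss. concat (map (\<lambda>t. S @ [t]) q) @ S = S @ ss" by (cases q) auto
  then obtain ss where "concat (map (\<lambda>t. S @ [t]) q) @ S = S @ ss" ..
  hence "concat (map (\<lambda>t. S @ [t]) T) @ S = concat (map (\<lambda>t. S @ [t]) p) @ (S @ [t] @ S) @ ss"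
    by (simp add: T)
  thus ?thesis unfolding sublist_def by blast
qed

section \<open>Rank-one subshifts with two spacers\<close>

text \<open>Place \<open>K 0\<close> with its first letter at the origin. Every later word extends
  the previous one strictly on both sides, so each coordinate is eventually filled and then keeps
  its letter.\<close>

lemma nested_words_limit:
  fixes K :: "nat \<Rightarrow> nat list"
  assumes K: "\<And>j. K (Suc j) = pre j @ K j @ post j" and ne: "\<And>j. pre j \<noteq> []" "\<And>j. post j \<noteq> []"
  obtains x where "\<And>i q. \<exists>j. sublist (seq_word x i q) (K j)"
    and "\<And>w. sublist w (K 0) \<Longrightarrow> \<exists>i. w = seq_word x i (length w)"
proof -
  \<comment> \<open>The number of letters of \<open>K j\<close> to the left of the origin.\<close>
  define off where "off j = (\<Sum>k<j. length (pre k))" for j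
  have off_Suc: "off (Suc j) = off j + length (pre j)" for j by (simp add: off_def)
  have pos: "0 < length (pre j)" "0 < length (post j)" for j using ne[of j] by simp_all
  have off_ge: "j \<le> off j" for j
  proof (induction j)
    case (Suc j) thus ?case using pos(1)[of j] unfolding off_Suc by linarith
  qed simp
  have len_ge: "off j + j \<le> length (K j)" for j
  proof (induction j)
    case (Suc j) thus ?case using pos(2)[of j] unfolding off_Suc K length_append by linarith
  qed (simp add: off_def)
  define letter where "letter j i = K j ! nat (i + int (off j))" for i :: int and j
  define inside where "inside j i \<longleftrightarrow> 0 \<le> i + int (off j) \<and> i + int (off j) < int (length (K j))" for i j
  have step: "inside (Suc j) i \<and> letter (Suc j) i = letter j i" if "inside j i" for i j
  proof
    show "inside (Suc j) i" using that by (simp add: inside_def off_Suc K)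
    have "nat (i + int (off (Suc j))) = length (pre j) + nat (i + int (off j))"
      using that unfolding inside_def off_Suc of_nat_add by linarith
    moreover have "nat (i + int (off j)) < length (K j)" using that by (auto simp: inside_def)
    ultimately show "letter (Suc j) i = letter j i" by (simp add: letter_def K nth_append)
  qed
  have stable: "inside (j + k) i \<and> letter (j + k) i = letter j i" if "inside j i" for i j k
    by (induction k) (use that step in auto)
  \<comment> \<open>\<open>K j\<close> has at least j letters on either side, counting the origin to
    the right.\<close>
  have inside_large: "inside j i" if "nat \<bar>i\<bar> < j" for i j
    using that off_ge[of j] len_ge[of j] unfolding inside_def by linarith
  define x where "x i = letter (Suc (nat \<bar>i\<bar>)) i" for i
  have x_at: "x i = letter j i" if "inside j i" for i j
  proof -
    have "letter (Suc (nat \<bar>i\<bar>) + j) i = x i" unfolding x_def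
      using stable[OF inside_large[of i "Suc (nat \<bar>i\<bar>)"], of j] by simp
    moreover have "letter (j + Suc (nat \<bar>i\<bar>)) i = letter j i" using stable[OF that, of "Suc (nat \<bar>i\<bar>)"] by simp
    ultimately show ?thesis by (simp add: add.commute)
  qed
  show ?thesis
  proof (rule that)
    fix i q
    define j where "j = nat \<bar>i\<bar> + q + 1"
    define m where "m = nat (i + int (off j))"
    have mi: "int m = i + int (off j)" using off_ge[of j] unfolding m_def j_def by linarith
    have mq: "m + q \<le> length (K j)" using mi len_ge[of j] unfolding j_def by linarith
    have "seq_word x i q = take q (drop m (K j))"
    proof (rule nth_equalityI)
      show "length (seq_word x i q) = length (take q (drop m (K j)))"
        using mq by (simp add: seq_word_def)
      fix k assume "k < length (seq_word x i q)"
      hence k: "k < q" by (simp add: seq_word_def)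
      hence "nat \<bar>i + int k\<bar> < j" unfolding j_def by linarith
      hence "x (i + int k) = letter j (i + int k)" by (intro x_at inside_large)
      also have "nat (i + int k + int (off j)) = m + k" using mi by linarith
      hence "letter j (i + int k) = K j ! (m + k)" by (simp add: letter_def)
      finally show "seq_word x i q ! k = take q (drop m (K j)) ! k"
        using k mq by (simp add: seq_word_def)
    qed
    thus "\<exists>j. sublist (seq_word x i q) (K j)"
      by (metis sublist_take sublist_drop sublist_order.order_trans)
  next
    fix w assume "sublist w (K 0)"
    then obtain p t where pt: "K 0 = p @ w @ t" by (auto simp: sublist_def)
    have "w = seq_word x (int (length p)) (length w)"
    proof (rule nth_equalityI)
      fix k assume k: "k < length w"
      have "inside 0 (int (length p) + int k)" using k by (simp add: inside_def off_def pt)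
      hence "x (int (length p) + int k) = letter 0 (int (length p) + int k)" by (rule x_at)
      also have "\<dots> = w ! k" using k by (simp add: letter_def off_def pt nat_int_add nth_append)
      finally show "w ! k = seq_word x (int (length p)) (length w) ! k"
        using k by (simp add: seq_word_def)
    qed (simp add: seq_word_def)
    thus "\<exists>i. w = seq_word x i (length w)" by blast
  qed
qed

section \<open>Blocks and language of the subshift\<close>

locale two_spacer_subshift =
  fixes r :: "nat \<Rightarrow> nat" and s :: "nat \<Rightarrow> nat \<Rightarrow> nat" and d N :: nat
  assumes cuts: "n \<ge> 1 \<Longrightarrow> r n > 0" and d: "d > 0" and N: "N \<ge> 1"
    and last_spacer: "n \<ge> N \<Longrightarrow> s n (r n) = 0"
    and spacer: "n \<ge> N \<Longrightarrow> i < r n \<Longrightarrow> s n i \<in> {0, d}"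
    and nonconstant: "n \<ge> N \<Longrightarrow> \<exists>i<r n. \<exists>j<r n. s n i \<noteq> s n j"
begin

abbreviation "b \<equiv> rk1_block r s"

definition lang :: "nat list set" where
  "lang = {w. \<exists>n\<ge>1. sublist w (b n)}"

text \<open>The final spacer \<open>s n (r n)\<close> is left out: it is 0 from level
  \<open>N\<close> on.\<close>

definition spacers :: "nat \<Rightarrow> bool list" where
  "spacers n = map (\<lambda>i. s n i = d) [0..<r n]"

lemma block_Suc:
  assumes "n \<ge> 1"
  shows "b (Suc n) = concat (map (\<lambda>i. b n @ replicate (s n i) 1) [0..<r n]) @ b n @ replicate (s n (r n)) 1"
  using assms by (cases n) simp_all

declare rk1_block.simps(3) [simp del]

lemma block_prefix_Suc:
  assumes "n \<ge> 1"
  shows "prefix (b n) (b (Suc n))"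
proof -
  have "[0..<r n] = 0 # [1..<r n]" using cuts[OF assms] by (simp add: upt_conv_Cons)
  thus ?thesis using block_Suc[OF assms] by simp
qed

lemma block_prefix:
  assumes "n \<ge> 1" "n \<le> m"
  shows "prefix (b n) (b m)"
  using assms(2)
proof (induction m rule: dec_induct)
  case (step m)
  thus ?case using block_prefix_Suc[of m] assms(1) by (meson order.trans prefix_order.order_trans)
qed simp

lemma block_hd:
  assumes "n \<ge> 1"
  shows "\<exists>w. b n = 0 # w"
  using block_prefix[of 1 n] assms by (auto simp: prefix_def)

lemma block_letters: "set (b n) \<subseteq> {0, 1}"
proof (induction n rule: less_induct)
  case (less n)
  show ?case
  proof (cases "n \<le> 1")
    case True thus ?thesis by (cases n) auto
  next
    case False
    then obtain m where m: "n = Suc m" "m \<ge> 1" by (cases n) auto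
    have "set (b m) \<subseteq> {0, 1}" using less m by simp
    thus ?thesis unfolding m(1) block_Suc[OF m(2)] by auto
  qed
qed

lemma spacers_both:
  assumes "n \<ge> N"
  shows "t \<in> set (spacers n)"
proof -
  obtain i j where ij: "i < r n" "j < r n" "s n i \<noteq> s n j" using nonconstant[OF assms] by blast
  have "s n i \<in> {0, d}" "s n j \<in> {0, d}" using spacer[OF assms] ij by blast+
  hence "(s n i = d) \<noteq> (s n j = d)" using ij(3) d by auto
  hence "(s n i = d) = t \<or> (s n j = d) = t" by blast
  thus ?thesis using ij(1,2) unfolding spacers_def by force
qed

text \<open>The trailing ones of each copy of \<open>b n\<close> merge with the spacer after it. As
  the final spacer is 0, the new block again ends in \<open>A 1^e\<close>.\<close>

lemma block_Suc_spell:
  assumes "n \<ge> N" "b n = A @ replicate e 1"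
  shows "b (Suc n) = spell A e d (spacers n) @ A @ replicate e 1"
proof -
  have "map (\<lambda>i. b n @ replicate (s n i) 1) [0..<r n]
      = map (\<lambda>i. A @ replicate (e + (if s n i = d then d else 0)) 1) [0..<r n]"
    using spacer[OF assms(1)] by (intro map_cong) (auto simp: assms(2) replicate_add)
  hence "concat (map (\<lambda>i. b n @ replicate (s n i) 1) [0..<r n]) = spell A e d (spacers n)"
    by (simp only: spell_def spacers_def map_map comp_def)
  thus ?thesis using assms N block_Suc[of n] last_spacer[OF assms(1)] by simp
qed

text \<open>Take for \<open>e\<close> the number of trailing ones of \<open>b N\<close>; passing to
  the next level preserves it. A single \<open>e\<close> for all levels is what makes the final
  error bounded.\<close>

lemma core_exists:
  "\<exists>e. \<forall>n\<ge>N. \<exists>A. b n = A @ replicate e 1 \<and> A \<noteq> [] \<and> hd A = 0 \<and> last A = 0"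
proof -
  have "0 \<in> set (b N)" using block_hd[OF N] by auto
  then obtain B zs where B: "b N = B @ 0 # zs" "0 \<notin> set zs" by (meson split_list_last)
  define e where "e = length zs"
  have "set zs \<subseteq> {1}" using B block_letters[of N] by auto
  hence zs: "zs = replicate e 1" unfolding e_def by (intro replicate_eqI) auto
  have "\<exists>A. b n = A @ replicate e 1 \<and> A \<noteq> [] \<and> hd A = 0 \<and> last A = 0" if "n \<ge> N" for n
    using that
  proof (induction n rule: dec_induct)
    case base
    obtain w where "b N = 0 # w" using block_hd[OF N] by blast
    hence "hd (B @ [0]) = 0" using B(1) by (cases B) auto
    thus ?case using B(1) zs by (intro exI[of _ "B @ [0]"]) simp
  next
    case (step n)
    then obtain A where A: "b n = A @ replicate e 1" "A \<noteq> []" "hd A = 0" "last A = 0" by blast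
    have "hd (spell A e d (spacers n) @ A) = 0" using A by (cases "spacers n") auto
    thus ?case using block_Suc_spell[OF step(1) A(1)] A by (intro exI[of _ "spell A e d (spacers n) @ A"]) simp
  qed
  thus ?thesis by blast
qed

definition e :: nat where
  "e = (SOME e. \<forall>n\<ge>N. \<exists>A. b n = A @ replicate e 1 \<and> A \<noteq> [] \<and> hd A = 0 \<and> last A = 0)"

definition core :: "nat \<Rightarrow> nat list" where
  "core n = take (length (b n) - e) (b n)"

lemma core:
  assumes "n \<ge> N"
  shows "b n = core n @ replicate e 1" "core n \<noteq> []" "hd (core n) = 0" "last (core n) = 0"
proof -
  obtain A where A: "b n = A @ replicate e 1" "A \<noteq> []" "hd A = 0" "last A = 0"
    using someI_ex[OF core_exists] assms unfolding e_def[symmetric] by blast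
  have "core n = A" by (simp add: core_def A(1))
  with A show "b n = core n @ replicate e 1" "core n \<noteq> []" "hd (core n) = 0" "last (core n) = 0"
    by simp_all
qed

lemma block_spell: "n \<ge> N \<Longrightarrow> b (Suc n) = spell (core n) e d (spacers n) @ core n @ replicate e 1"
  using block_Suc_spell core(1) by blast

lemma core_Suc: "n \<ge> N \<Longrightarrow> core (Suc n) = spell (core n) e d (spacers n) @ core n"
  using block_spell[of n] core(1)[of "Suc n"] by simp

lemma in_lang: "n \<ge> N \<Longrightarrow> sublist w (b n) \<Longrightarrow> w \<in> lang"
  using N unfolding lang_def mem_Collect_eq by (meson order.trans)

lemma lang_block:
  assumes "w \<in> lang"
  obtains n where "n \<ge> N" "sublist w (b n)"
proof -
  obtain n where n: "n \<ge> 1" "sublist w (b n)" using assms unfolding lang_def by blast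
  have "prefix (b n) (b (max n N))" using n by (intro block_prefix) simp_all
  hence "sublist w (b (max n N))" using n by (meson prefix_imp_sublist sublist_order.order_trans)
  thus ?thesis using that[of "max n N"] by simp
qed

text \<open>Non-constancy puts both spacers inside the next block. Right special blocks, left
  special cores and the words \<open>U t U\<close> all come from this.\<close>

lemma core_spacer_core:
  assumes "n \<ge> N"
  shows "spell (core n) e d [t] @ core n @ replicate e 1 \<in> lang"
proof -
  have "sublist [t] (spacers n)"
    using spacers_both[OF assms, of t] by (metis append_Cons append_Nil split_list sublist_appendI)
  hence "sublist (spell (core n) e d [t] @ core n @ replicate e 1) (b (Suc n))"
    unfolding block_spell[OF assms] by (rule sublist_spell_spacer)
  thus ?thesis using assms by (intro in_lang[of "Suc n"]) simp_all
qed

lemma lang_factor: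
  assumes "w \<in> lang" "sublist u w"
  shows "u \<in> lang"
  using assms sublist_order.order_trans unfolding lang_def by blast

lemma lang_binary: "w \<in> lang \<Longrightarrow> set w \<subseteq> {0, 1}"
  unfolding lang_def using block_letters set_mono_sublist by blast

lemma block_0:
  assumes "n \<ge> N"
  shows "b n @ [0] \<in> lang"
proof (rule lang_factor[OF core_spacer_core[OF assms, of False]])
  obtain A where "core n = 0 # A" using core(2,3)[OF assms] by (cases "core n") auto
  thus "sublist (b n @ [0]) (spell (core n) e d [False] @ core n @ replicate e 1)"
    using core(1)[OF assms] by (simp add: sublist_def) (metis append_Nil)
qed

lemma block_1:
  assumes "n \<ge> N"
  shows "b n @ [1] \<in> lang"
proof (rule lang_factor[OF core_spacer_core[OF assms, of True]])
  obtain d' where "d = Suc d'" using d by (cases d) auto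
  hence "spell (core n) e d [True] @ core n @ replicate e 1
    = [] @ (b n @ [1]) @ replicate d' 1 @ core n @ replicate e 1"
    using core(1)[OF assms] by (simp add: replicate_add replicate_app_Cons_same)
  thus "sublist (b n @ [1]) (spell (core n) e d [True] @ core n @ replicate e 1)"
    unfolding sublist_def by blast
qed

lemma lang_extend:
  assumes "w \<in> lang"
  shows "\<exists>a. w @ [a] \<in> lang"
proof -
  obtain n where n: "n \<ge> N" "sublist w (b n)" using lang_block[OF assms] .
  then obtain p q where pq: "b n = p @ w @ q" by (auto simp: sublist_def)
  obtain a q' where a: "q @ [0] = a # q'" by (cases q) auto
  have "b n @ [0] = p @ (w @ [a]) @ q'" using a by (simp add: pq)
  hence "sublist (w @ [a]) (b n @ [0])" unfolding sublist_def by blast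
  with block_0[OF n(1)] lang_factor show ?thesis by blast
qed

lemma block_Suc_suffix:
  assumes "n \<ge> N"
  obtains k where "b (Suc n) = k @ b n" "k \<noteq> []"
proof -
  have "spell (core n) e d (spacers n) \<noteq> []"
    using spacers_both[OF assms, of True] core(2)[OF assms] by (cases "spacers n") auto
  thus ?thesis using that[of "spell (core n) e d (spacers n)"] block_spell[OF assms] core(1)[OF assms] by simp
qed

text \<open>Each block is a proper suffix of the next. This becomes right extendability of the
  reversed language.\<close>

lemma lang_extend_left:
  assumes "w \<in> lang"
  shows "\<exists>a. a # w \<in> lang"
proof -
  obtain n where n: "n \<ge> N" "sublist w (b n)" using lang_block[OF assms] .
  then obtain p q where pq: "b n = p @ w @ q" by (auto simp: sublist_def)
  obtain k where k: "b (Suc n) = k @ b n" "k \<noteq> []" using block_Suc_suffix[OF n(1)] .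
  have "k @ p \<noteq> []" using k by simp
  then obtain k' a where "k @ p = k' @ [a]" by (metis append_butlast_last_id)
  moreover have "b (Suc n) = (k @ p) @ w @ q" using k pq by simp
  ultimately have "b (Suc n) = k' @ (a # w) @ q" by simp
  hence "sublist (a # w) (b (Suc n))" unfolding sublist_def by blast
  with n show ?thesis using in_lang[of "Suc n"] by auto
qed

sublocale binary_language lang
  by unfold_locales (use lang_factor lang_binary lang_extend in blast)+

text \<open>A factor of a block has to occur in a bi-infinite point; such a point is the limit of
  blocks each lying strictly inside the next.\<close>

lemma rk1_complexity_eq: "rk1_complexity r s q = complexity q"
proof -
  have "w \<in> lang" if "x \<in> rk1_subshift r s" "w = seq_word x i q" for x w i
    using that unfolding rk1_subshift_def lang_def by blast
  moreover have "\<exists>x\<in>rk1_subshift r s. \<exists>i. w = seq_word x i (length w)" if w: "w \<in> lang" for w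
  proof -
    obtain n where n: "n \<ge> N" "sublist w (b n)" using lang_block[OF w] .
    have inner: "\<exists>pre post. b (Suc m) = pre @ b m @ post \<and> pre \<noteq> [] \<and> post \<noteq> []" if m: "m \<ge> N" for m
    proof -
      \<comment> \<open>Non-constancy forces \<open>r m \<ge> 2\<close>, hence at least three copies
        of \<open>b m\<close>; the second has letters on both sides.\<close>
      have "length (spacers m) \<ge> 2"
        using nonconstant[OF m] by (cases "r m"; cases "r m - 1") (auto simp: spacers_def)
      then obtain x y v where v: "spacers m = x # y # v"
        by (metis Suc_le_length_iff numeral_2_eq_2)
      have "b (Suc m) = (core m @ replicate (e + (if x then d else 0)) 1) @ b m @
          (replicate (if y then d else 0) 1 @ spell (core m) e d v @ b m)"
        using block_spell[OF m] core(1)[OF m] by (simp add: v replicate_add)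
      moreover have "b m \<noteq> []" using core(1,2)[OF m] by simp
      ultimately show ?thesis using core(2)[OF m] by blast
    qed
    have "\<forall>j. \<exists>pre post. b (n + Suc j) = pre @ b (n + j) @ post \<and> pre \<noteq> [] \<and> post \<noteq> []"
      using inner n(1) by simp
    then obtain pre post where pp: "\<And>j. b (n + Suc j) = pre j @ b (n + j) @ post j"
       "\<And>j. pre j \<noteq> []" "\<And>j. post j \<noteq> []" by metis
    obtain x where x: "\<And>i q. \<exists>j. sublist (seq_word x i q) (b (n + j))"
      "\<And>w. sublist w (b (n + 0)) \<Longrightarrow> \<exists>i. w = seq_word x i (length w)"
      using nested_words_limit[of "\<lambda>j. b (n + j)" pre post] pp by blast
    have "x i \<in> {0, 1}" for i
    proof -
      obtain j where "sublist (seq_word x i 1) (b (n + j))" using x(1) by blast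
      hence "set (seq_word x i 1) \<subseteq> {0, 1}" using block_letters set_mono_sublist by blast
      thus ?thesis by (simp add: seq_word_def)
    qed
    moreover have "\<exists>m\<ge>1. sublist (seq_word x i q) (b m)" for i q
    proof -
      obtain j where "sublist (seq_word x i q) (b (n + j))" using x(1) by blast
      moreover have "n + j \<ge> 1" using n(1) N by simp
      ultimately show ?thesis by blast
    qed
    ultimately have "x \<in> rk1_subshift r s" unfolding rk1_subshift_def by blast
    moreover have "\<exists>i. w = seq_word x i (length w)" using x(2) n(2) by simp
    ultimately show ?thesis by blast
  qed
  ultimately have "{w. \<exists>x\<in>rk1_subshift r s. \<exists>i. w = seq_word x i q} = {w \<in> lang. length w = q}"
    by (auto simp: seq_word_def)
  thus ?thesis unfolding rk1_complexity_def complexity_def by simp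
qed

section \<open>Two levels of blocks, read forwards and backwards\<close>

definition spacer_word :: "nat \<Rightarrow> bool list" where
  "spacer_word n = concat (map (\<lambda>t. spacers n @ [t]) (spacers (Suc n))) @ spacers n"

lemma core_spacer_word: "n \<ge> N \<Longrightarrow> core (Suc (Suc n)) = spell (core n) e d (spacer_word n) @ core n"
  using core_Suc[of n] core_Suc[of "Suc n"] spell_nested[of "core n" e d "spacers n" "spacers (Suc n)"]
  by (simp add: spacer_word_def)

lemma spacer_word_twice:
  assumes "n \<ge> N"
  shows "spell (core n) e d (spacer_word n @ [t] @ spacer_word n) @ core n \<in> lang"
proof -
  have "spell (core n) e d (spacer_word n @ [t] @ spacer_word n) @ core n
    = spell (core (Suc (Suc n))) e d [t] @ core (Suc (Suc n))"
    by (simp add: core_spacer_word[OF assms])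
  thus ?thesis using core_spacer_core[of "Suc (Suc n)" t] assms
    by (metis append_assoc lang_factor le_Suc_eq sublist_append_rightI)
qed

lemma block_suffix_long: "m \<ge> N \<Longrightarrow> \<exists>K. b (m + j) = K @ b m \<and> j \<le> length K"
proof (induction j)
  case (Suc j)
  then obtain K where K: "b (m + j) = K @ b m" "j \<le> length K" by blast
  obtain k where "b (Suc (m + j)) = k @ b (m + j)" "k \<noteq> []" using block_Suc_suffix[of "m + j"] Suc by auto
  thus ?case using K by (intro exI[of _ "k @ K"]) (cases k, auto)
qed simp

text \<open>The counterpart of \<open>block_suffix_long\<close> for the reversed language, whose
  stems end in reversed prefixes.\<close>

lemma core_prefix_long: "m \<ge> N \<Longrightarrow> \<exists>K. core (m + j) = core m @ K \<and> j \<le> length K"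
proof (induction j)
  case (Suc j)
  then obtain K where K: "core (m + j) = core m @ K" "j \<le> length K" by blast
  obtain t v where tv: "spacers (m + j) = t # v"
    using spacers_both[of "m + j" True] Suc by (cases "spacers (m + j)") auto
  have "core (Suc (m + j)) = core (m + j) @ replicate (e + (if t then d else 0)) 1
      @ spell (core (m + j)) e d v @ core (m + j)"
    using core_Suc[of "m + j"] Suc by (simp add: tv)
  moreover have "core (m + j) \<noteq> []" using core(2)[of "m + j"] Suc by simp
  hence "length (core (m + j)) \<ge> 1" by (cases "core (m + j)") auto
  ultimately show ?case using K by (intro exI[of _ "K @ replicate (e + (if t then d else 0)) 1
      @ spell (core (m + j)) e d v @ core (m + j)"]) simp
qed simp

lemma forward_tower:
  assumes "n \<ge> N"
  shows "tower_language lang (core n) e d (spacer_word n)"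
proof unfold_locales
  show "core n \<noteq> []" "hd (core n) = 0" "last (core n) = 0" using core[OF assms] by simp_all
  show "d > 0" by (rule d)
  show "spell (core n) e d (spacer_word n @ [t] @ spacer_word n) @ core n \<in> lang" for t by (rule spacer_word_twice[OF assms])
  fix l
  obtain K where K: "b (Suc (Suc n) + l) = K @ b (Suc (Suc n))" "l \<le> length K"
    using block_suffix_long[of "Suc (Suc n)" l] assms by auto
  have "b (Suc (Suc n)) = spell (core n) e d (spacer_word n) @ core n @ replicate e 1"
    using core(1)[of "Suc (Suc n)"] core_spacer_word[OF assms] assms by simp
  moreover have "special (b (Suc (Suc n) + l))"
    unfolding special_def using block_0 block_1 assms by simp
  ultimately show "\<exists>K. l \<le> length K \<and> special (K @ spell (core n) e d (spacer_word n) @ core n @ replicate e 1)"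
    using K by auto
qed

lemma rev_lang_binary: "binary_language (rev ` lang)"
proof
  show "u \<in> rev ` lang" if "w \<in> rev ` lang" "sublist u w" for w u
  proof -
    have "rev w \<in> lang" "sublist (rev u) (rev w)" using that by (auto simp: sublist_rev)
    hence "rev u \<in> lang" by (rule lang_factor)
    thus ?thesis by (metis image_eqI rev_rev_ident)
  qed
  show "set w \<subseteq> {0, 1}" if "w \<in> rev ` lang" for w using that lang_binary by force
  show "\<exists>a. w @ [a] \<in> rev ` lang" if w: "w \<in> rev ` lang" for w
  proof -
    have "rev w \<in> lang" using w by auto
    then obtain a where "a # rev w \<in> lang" using lang_extend_left by blast
    hence "rev (a # rev w) \<in> rev ` lang" by (rule imageI)
    thus ?thesis by auto
  qed
qed

lemma rev_complexity: "binary_language.complexity (rev ` lang) q = complexity q"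
proof -
  have "{w \<in> rev ` lang. length w = q} = rev ` {w \<in> lang. length w = q}" by auto
  thus ?thesis unfolding complexity_def binary_language.complexity_def[OF rev_lang_binary]
    by (simp add: card_image)
qed

text \<open>Read forwards: 1^e before a core is preceded by 0, the end of another core, or by 1,
  inside the longer spacer. The block carries its 1^e on the right, so here the ones change
  sides.\<close>

lemma special_rev_core:
  assumes "n \<ge> N"
  shows "binary_language.special (rev ` lang) (rev (core n) @ replicate e 1)"
proof -
  have "(if x then 1 else 0) # replicate e 1 @ core n \<in> lang" for x
  proof -
    let ?w = "(if x then 1 else 0) # replicate e 1 @ core n"
    have "suffix (?w @ replicate e 1) (spell (core n) e d [x] @ core n @ replicate e 1)"
      using spell_marker[OF core(2,4)[OF assms] d, of x e "[]"] by simp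
    hence "?w @ replicate e 1 \<in> lang"
      using core_spacer_core[OF assms] lang_factor by (meson suffix_imp_sublist)
    thus ?thesis by (rule lang_factor) simp
  qed
  hence "rev ((if x then 1 else 0) # replicate e 1 @ core n) \<in> rev ` lang" for x by blast
  from this[of True] this[of False] show ?thesis
    unfolding binary_language.special_def[OF rev_lang_binary] by simp
qed

lemma backward_tower:
  assumes "n \<ge> N"
  shows "tower_language (rev ` lang) (rev (core n)) e d (rev (spacer_word n))"
proof (intro tower_language.intro rev_lang_binary, unfold_locales)
  show "rev (core n) \<noteq> []" "hd (rev (core n)) = 0" "last (rev (core n)) = 0"
    using core[OF assms] by (simp_all add: hd_rev last_rev)
  show "d > 0" by (rule d)
  have rc: "spell (rev (core n)) e d (rev (spacer_word n)) @ rev (core n) = rev (core (Suc (Suc n)))"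
    unfolding core_spacer_word[OF assms] rev_spell ..
  show "spell (rev (core n)) e d (rev (spacer_word n) @ [t] @ rev (spacer_word n)) @ rev (core n) \<in> rev ` lang" for t
  proof -
    have "rev (spell (core n) e d (spacer_word n @ [t] @ spacer_word n) @ core n) \<in> rev ` lang"
      using spacer_word_twice[OF assms] by (rule imageI)
    thus ?thesis unfolding rev_spell by simp
  qed
  fix l
  obtain K where K: "core (Suc (Suc n) + l) = core (Suc (Suc n)) @ K" "l \<le> length K"
    using core_prefix_long[of "Suc (Suc n)" l] assms by auto
  have "binary_language.special (rev ` lang) (rev (core (Suc (Suc n) + l)) @ replicate e 1)"
    using assms by (intro special_rev_core) simp
  hence "binary_language.special (rev ` lang)
     (rev K @ spell (rev (core n)) e d (rev (spacer_word n)) @ rev (core n) @ replicate e 1)"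
    unfolding K(1) using rc by (metis append_assoc rev_append)
  thus "\<exists>K. l \<le> length K \<and> binary_language.special (rev ` lang)
     (K @ spell (rev (core n)) e d (rev (spacer_word n)) @ rev (core n) @ replicate e 1)"
    using K(2) by (metis length_rev)
qed

lemma complexity_growth:
  assumes "n \<ge> N"
  shows "\<exists>q\<ge>length (b n). 3 * q + 2 * complexity (length (b n))
    \<le> 2 * complexity q + 2 * length (b n) + 4 * (e + 1)"
proof -
  interpret F: tower_language lang "core n" e d "spacer_word n" by (rule forward_tower[OF assms])
  interpret R: tower_language "rev ` lang" "rev (core n)" e d "rev (spacer_word n)" by (rule backward_tower[OF assms])
  let ?h = "length (core n) + e"
  have hb: "length (b n) = ?h" by (subst core(1)[OF assms]) simp
  have "prefix (spacers n) (spacer_word n)"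
    using spacers_both[of "Suc n" True] assms unfolding spacer_word_def by (cases "spacers (Suc n)") auto
  moreover have "suffix (spacers n) (spacer_word n)" unfolding spacer_word_def by (simp add: suffix_def)
  moreover have "sublist (spacers n @ [t] @ spacers n) (spacer_word n)" for t
    unfolding spacer_word_def using assms by (intro sublist_nested spacers_both) simp
  ultimately have "one_family ?h d (spacer_word n) \<or> two_families ?h d (spacer_word n)
      \<or> one_family ?h d (rev (spacer_word n)) \<or> two_families ?h d (rev (spacer_word n))"
    using families_exist spacers_both[OF assms] by blast
  \<comment> \<open>Reversal preserves the complexity and the length of the core, so both towers
    give the same inequality.\<close>
  thus ?thesis unfolding hb
    using F.complexity_one_family F.complexity_two_families R.complexity_one_family R.complexity_two_families
    unfolding rev_complexity length_rev by blast
qed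

end

theorem theorem3p3:
  fixes r :: "nat \<Rightarrow> nat" and s :: "nat \<Rightarrow> nat \<Rightarrow> nat" and d :: nat
  assumes r_pos: "\<forall>n\<ge>1. r n > 0"
    and d_pos: "d > 0"
    and spacers: "\<exists>N. \<forall>n\<ge>N. s n (r n) = 0 \<and> (\<forall>i<r n. s n i \<in> {0, d})
                     \<and> (\<exists>i<r n. \<exists>j<r n. s n i \<noteq> s n j)"
  shows "\<exists>C::real. \<exists>N. \<forall>n\<ge>N. \<exists>q\<ge>length (rk1_block r s n).
           real (rk1_complexity r s q) \<ge> 1.5 * real q
             + (real (rk1_complexity r s (length (rk1_block r s n))) - real (length (rk1_block r s n))) - C"
proof -
  obtain N where N: "\<forall>n\<ge>N. s n (r n) = 0 \<and> (\<forall>i<r n. s n i \<in> {0, d}) \<and> (\<exists>i<r n. \<exists>j<r n. s n i \<noteq> s n j)"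
    using spacers ..
  interpret two_spacer_subshift r s d "max 1 N"
    by unfold_locales (use r_pos d_pos N in auto)
  show ?thesis
  \<comment> \<open>The constant is half of 4(e + 1), because \<open>complexity_growth\<close>
    states twice the desired inequality.\<close>
  proof (rule exI[of _ "2 * (real e + 1)"], rule exI[of _ "max 1 N"], intro allI impI)
    fix n assume "max 1 N \<le> n"
    then obtain q where q: "q \<ge> length (b n)"
      "3 * q + 2 * complexity (length (b n)) \<le> 2 * complexity q + 2 * length (b n) + 4 * (e + 1)"
      using complexity_growth by blast
    have "real (3 * q + 2 * complexity (length (b n))) \<le> real (2 * complexity q + 2 * length (b n) + 4 * (e + 1))"
      using q(2) by (rule of_nat_mono)
    thus "\<exists>q\<ge>length (b n). real (rk1_complexity r s q) \<ge> 1.5 * real q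
        + (real (rk1_complexity r s (length (b n))) - real (length (b n))) - 2 * (real e + 1)"
      using q(1) unfolding rk1_complexity_eq by (intro exI[of _ q]) simp
  qed
qed

end
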